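(* Let $X$ be a set, $S$ a finite subset of the free monoid $\langle X\rangle$, and $M=\langle X:\mathbf{i}(S)\rangle$ the monoid obtained by adjoining to $\langle X\rangle$ universal two-sided inverses to all elements of $S$. Then either there is a subset $X_0\subseteq X$ such that $M$ is (via the natural map on $X$) the free product, as monoids, of the free group on $X_0$ with the free monoid on $X\setminus X_0$ (in particular, $M$ is the free group on $X$ in the case $X_0=X$), or $M$ contains one-sided invertible elements that are not two-sided invertible.
   Context: $\langle X\rangle$ is the free monoid on $X$. $\langle X:\mathbf{i}(S)\rangle$ is the monoid presented by generators $X\cup\{\mathbf{i}(w):w\in S\}$ (with the $\mathbf{i}(w)$ new symbols) and relations $w\,\mathbf{i}(w)=1=\mathbf{i}(w)\,w$ for $w\in S$. *)

theory Defs
  imports "HOL-Algebra.Group"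
begin

definition free_monoid :: "'a set \<Rightarrow> 'a list monoid" where
  "free_monoid X = \<lparr>carrier = lists X, mult = (@), one = []\<rparr>"

text \<open>The congruence on the free monoid on \<open>A\<close> generated by the pairs in \<open>R\<close>.\<close>

inductive_set monoid_cong :: "'g set \<Rightarrow> ('g list \<times> 'g list) set \<Rightarrow> ('g list \<times> 'g list) set"
  for A :: "'g set" and R :: "('g list \<times> 'g list) set" where
  refl: "w \<in> lists A \<Longrightarrow> (w, w) \<in> monoid_cong A R"
| sym: "(u, v) \<in> monoid_cong A R \<Longrightarrow> (v, u) \<in> monoid_cong A R"
| trans: "(u, v) \<in> monoid_cong A R \<Longrightarrow> (v, w) \<in> monoid_cong A R \<Longrightarrow> (u, w) \<in> monoid_cong A R"
| rel: "(u, v) \<in> R \<Longrightarrow> u \<in> lists A \<Longrightarrow> v \<in> lists A \<Longrightarrow> p \<in> lists A \<Longrightarrow> q \<in> lists A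
    \<Longrightarrow> (p @ u @ q, p @ v @ q) \<in> monoid_cong A R"

definition pres_class :: "'g set \<Rightarrow> ('g list \<times> 'g list) set \<Rightarrow> 'g list \<Rightarrow> 'g list set" where
  "pres_class A R w = monoid_cong A R `` {w}"

definition presented_monoid :: "'g set \<Rightarrow> ('g list \<times> 'g list) set \<Rightarrow> 'g list set monoid" where
  "presented_monoid A R =
    \<lparr>carrier = lists A // monoid_cong A R,
     mult = (\<lambda>U V. \<Union>u\<in>U. \<Union>v\<in>V. pres_class A R (u @ v)),
     one = pres_class A R []\<rparr>"

lemma monoid_cong_lists:
  "(u, v) \<in> monoid_cong A R \<Longrightarrow> u \<in> lists A \<and> v \<in> lists A"
  by (induction rule: monoid_cong.induct) auto

lemma equiv_monoid_cong: "equiv (lists A) (monoid_cong A R)"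
proof (rule equivI)
  show "monoid_cong A R \<subseteq> lists A \<times> lists A"
    using monoid_cong_lists by fast
  show "refl_on (lists A) (monoid_cong A R)"
    by (rule refl_onI) (rule monoid_cong.refl)
  show "sym (monoid_cong A R)" by (rule symI) (rule monoid_cong.sym)
  show "trans (monoid_cong A R)" by (rule transI) (rule monoid_cong.trans)
qed

lemma monoid_cong_context:
  "(u, v) \<in> monoid_cong A R \<Longrightarrow> p \<in> lists A \<Longrightarrow> q \<in> lists A
    \<Longrightarrow> (p @ u @ q, p @ v @ q) \<in> monoid_cong A R"
proof (induction rule: monoid_cong.induct)
  case (refl w)
  then show ?case by (simp add: monoid_cong.refl)
next
  case (sym u v)
  show ?case by (rule monoid_cong.sym[OF sym.IH[OF sym.prems]])
next
  case (trans u v w)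
  show ?case by (rule monoid_cong.trans[OF trans.IH(1)[OF trans.prems] trans.IH(2)[OF trans.prems]])
next
  case (rel u v p' q')
  have "((p @ p') @ u @ (q' @ q), (p @ p') @ v @ (q' @ q)) \<in> monoid_cong A R"
    by (rule monoid_cong.rel) (use rel in auto)
  then show ?case by simp
qed

lemma monoid_cong_append:
  assumes "(u, u') \<in> monoid_cong A R" "(v, v') \<in> monoid_cong A R"
  shows "(u @ v, u' @ v') \<in> monoid_cong A R"
proof -
  have "(u @ v, u' @ v) \<in> monoid_cong A R"
    using monoid_cong_context[OF assms(1), of "[]" v] monoid_cong_lists[OF assms(2)] by simp
  moreover have "(u' @ v, u' @ v') \<in> monoid_cong A R"
    using monoid_cong_context[OF assms(2), of u' "[]"] monoid_cong_lists[OF assms(1)] by simp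
  ultimately show ?thesis by (rule monoid_cong.trans)
qed

lemma pres_class_eq_iff:
  "u \<in> lists A \<Longrightarrow> v \<in> lists A \<Longrightarrow>
    pres_class A R u = pres_class A R v \<longleftrightarrow> (u, v) \<in> monoid_cong A R"
  unfolding pres_class_def by (rule eq_equiv_class_iff[OF equiv_monoid_cong])

lemma carrier_presented_monoid:
  "carrier (presented_monoid A R) = pres_class A R ` lists A"
  by (auto simp: presented_monoid_def quotient_def pres_class_def)

lemma one_presented_monoid: "\<one>\<^bsub>presented_monoid A R\<^esub> = pres_class A R []"
  by (simp add: presented_monoid_def)

lemma mult_presented_monoid:
  assumes "u \<in> lists A" "v \<in> lists A"
  shows "pres_class A R u \<otimes>\<^bsub>presented_monoid A R\<^esub> pres_class A R v = pres_class A R (u @ v)"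
proof -
  have eq: "pres_class A R (u' @ v') = pres_class A R (u @ v)"
    if "u' \<in> pres_class A R u" "v' \<in> pres_class A R v" for u' v'
  proof -
    have "(u @ v, u' @ v') \<in> monoid_cong A R"
      using that by (intro monoid_cong_append) (auto simp: pres_class_def)
    then show ?thesis
      unfolding pres_class_def using equiv_class_eq[OF equiv_monoid_cong] by metis
  qed
  have "u \<in> pres_class A R u" "v \<in> pres_class A R v"
    using assms by (auto simp: pres_class_def intro: monoid_cong.refl)
  then have "(\<Union>u'\<in>pres_class A R u. \<Union>v'\<in>pres_class A R v. pres_class A R (u' @ v')) =
      pres_class A R (u @ v)"
    using eq by blast
  then show ?thesis by (simp add: presented_monoid_def)
qed

lemma monoid_presented_monoid: "monoid (presented_monoid A R)"
proof -
  have app: "u @ v \<in> lists A" if "u \<in> lists A" "v \<in> lists A" for u v using that by simp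
  show ?thesis
    by (rule monoidI; unfold carrier_presented_monoid one_presented_monoid; (elim imageE)?;
        (hypsubst)?;
        simp only: mult_presented_monoid app lists.Nil append_Nil append_Nil2 append_assoc imageI)
qed

text \<open>The symbol \<open>Adj w\<close> stands for the formal inverse \<open>i(w)\<close>.\<close>

datatype 'a adj_gen = Gen 'a | Adj "'a list"

definition adj_gens :: "'a set \<Rightarrow> 'a list set \<Rightarrow> 'a adj_gen set" where
  "adj_gens X S = Gen ` X \<union> Adj ` S"

definition adj_rels :: "'a list set \<Rightarrow> ('a adj_gen list \<times> 'a adj_gen list) set" where
  "adj_rels S = (\<Union>w\<in>S. {(map Gen w @ [Adj w], []), ([Adj w] @ map Gen w, [])})"

definition adj_monoid :: "'a set \<Rightarrow> 'a list set \<Rightarrow> 'a adj_gen list set monoid" where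
  "adj_monoid X S = presented_monoid (adj_gens X S) (adj_rels S)"

definition adj_of :: "'a set \<Rightarrow> 'a list set \<Rightarrow> 'a \<Rightarrow> 'a adj_gen list set" where
  "adj_of X S x = pres_class (adj_gens X S) (adj_rels S) [Gen x]"

datatype 'a letter = Pos 'a | Neg 'a

definition free_group_gens :: "'a set \<Rightarrow> 'a letter set" where
  "free_group_gens X = Pos ` X \<union> Neg ` X"

definition free_group_rels :: "'a set \<Rightarrow> ('a letter list \<times> 'a letter list) set" where
  "free_group_rels X = (\<Union>x\<in>X. {([Pos x, Neg x], []), ([Neg x, Pos x], [])})"

definition free_group :: "'a set \<Rightarrow> 'a letter list set monoid" where
  "free_group X = presented_monoid (free_group_gens X) (free_group_rels X)"

definition free_group_of :: "'a set \<Rightarrow> 'a \<Rightarrow> 'a letter list set" where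
  "free_group_of X x = pres_class (free_group_gens X) (free_group_rels X) [Pos x]"

lemma group_free_group: "group (free_group X)"
proof -
  let ?A = "free_group_gens X" and ?R = "free_group_rels X"
  have inv: "\<exists>v\<in>lists ?A. (v @ u, []) \<in> monoid_cong ?A ?R" if "u \<in> lists ?A" for u
    using that
  proof (induction rule: lists.induct)
    case Nil
    have "([] @ [], []) \<in> monoid_cong ?A ?R" by (simp add: monoid_cong.refl)
    then show ?case by (rule bexI) simp
  next
    case (Cons a u)
    obtain v where v: "v \<in> lists ?A" "(v @ u, []) \<in> monoid_cong ?A ?R"
      using Cons.IH by blast
    obtain b where b: "b \<in> ?A" "([b, a], []) \<in> ?R"
    proof -
      have "a \<in> ?A" using Cons.hyps by simp
      then consider x where "x \<in> X" "a = Pos x" | x where "x \<in> X" "a = Neg x"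
        unfolding free_group_gens_def by blast
      then show ?thesis
      proof cases
        case 1
        show ?thesis
          by (rule that[of "Neg x"])
             (use 1 in \<open>simp_all add: free_group_gens_def free_group_rels_def\<close>)
      next
        case 2
        show ?thesis
          by (rule that[of "Pos x"])
             (use 2 in \<open>simp_all add: free_group_gens_def free_group_rels_def\<close>)
      qed
    qed
    have "(v @ [b, a] @ u, v @ [] @ u) \<in> monoid_cong ?A ?R"
      using b v Cons.hyps by (intro monoid_cong.rel) simp_all
    then have "((v @ [b]) @ a # u, v @ u) \<in> monoid_cong ?A ?R" by simp
    then have "((v @ [b]) @ a # u, []) \<in> monoid_cong ?A ?R"
      using v(2) by (rule monoid_cong.trans)
    moreover have "v @ [b] \<in> lists ?A" using b v by simp
    ultimately show ?case by (rule bexI)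
  qed
  interpret monoid "free_group X"
    unfolding free_group_def by (rule monoid_presented_monoid)
  show ?thesis
  proof (rule groupI)
    fix x assume "x \<in> carrier (free_group X)"
    then obtain u where u: "u \<in> lists ?A" "x = pres_class ?A ?R u"
      unfolding free_group_def carrier_presented_monoid by blast
    obtain v where v: "v \<in> lists ?A" "(v @ u, []) \<in> monoid_cong ?A ?R" using inv u by blast
    have "pres_class ?A ?R v \<otimes>\<^bsub>free_group X\<^esub> x = \<one>\<^bsub>free_group X\<^esub>"
    proof -
      have "v @ u \<in> lists ?A" using u v by simp
      then have "pres_class ?A ?R (v @ u) = pres_class ?A ?R []"
        using pres_class_eq_iff[of "v @ u" ?A "[]" ?R] v(2) by blast
      then show ?thesis
        unfolding free_group_def u(2) one_presented_monoid mult_presented_monoid[OF v(1) u(1)] .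
    qed
    then show "\<exists>y\<in>carrier (free_group X). y \<otimes>\<^bsub>free_group X\<^esub> x = \<one>\<^bsub>free_group X\<^esub>"
      using v(1) unfolding free_group_def carrier_presented_monoid by blast
  qed (auto simp: m_assoc)
qed

text \<open>The free product (coproduct) of monoids, presented by the disjoint union of the
  carriers subject to the multiplication tables and the identification of both units
  with the empty word.\<close>

definition free_product_gens ::
  "('a, 'c) monoid_scheme \<Rightarrow> ('b, 'd) monoid_scheme \<Rightarrow> ('a + 'b) set" where
  "free_product_gens G H = carrier G <+> carrier H"

definition free_product_rels ::
  "('a, 'c) monoid_scheme \<Rightarrow> ('b, 'd) monoid_scheme \<Rightarrow> (('a + 'b) list \<times> ('a + 'b) list) set" where
  "free_product_rels G H =
    {([Inl a, Inl a'], [Inl (a \<otimes>\<^bsub>G\<^esub> a')]) | a a'. a \<in> carrier G \<and> a' \<in> carrier G} \<union>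
    {([Inr b, Inr b'], [Inr (b \<otimes>\<^bsub>H\<^esub> b')]) | b b'. b \<in> carrier H \<and> b' \<in> carrier H} \<union>
    {([Inl \<one>\<^bsub>G\<^esub>], []), ([Inr \<one>\<^bsub>H\<^esub>], [])}"

definition free_product ::
  "('a, 'c) monoid_scheme \<Rightarrow> ('b, 'd) monoid_scheme \<Rightarrow> ('a + 'b) list set monoid" where
  "free_product G H = presented_monoid (free_product_gens G H) (free_product_rels G H)"

definition free_product_inl ::
  "('a, 'c) monoid_scheme \<Rightarrow> ('b, 'd) monoid_scheme \<Rightarrow> 'a \<Rightarrow> ('a + 'b) list set" where
  "free_product_inl G H a = pres_class (free_product_gens G H) (free_product_rels G H) [Inl a]"

definition free_product_inr ::
  "('a, 'c) monoid_scheme \<Rightarrow> ('b, 'd) monoid_scheme \<Rightarrow> 'b \<Rightarrow> ('a + 'b) list set" where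
  "free_product_inr G H b = pres_class (free_product_gens G H) (free_product_rels G H) [Inr b]"

definition one_sided_invertible :: "('a, 'c) monoid_scheme \<Rightarrow> 'a \<Rightarrow> bool" where
  "one_sided_invertible M a \<longleftrightarrow> a \<in> carrier M \<and>
    ((\<exists>b\<in>carrier M. a \<otimes>\<^bsub>M\<^esub> b = \<one>\<^bsub>M\<^esub>) \<or> (\<exists>b\<in>carrier M. b \<otimes>\<^bsub>M\<^esub> a = \<one>\<^bsub>M\<^esub>))"

end

(* Suppose every one-sided invertible element of M is a unit. If w = x_1 ... x_n lies in S, then
   x_1 is right invertible in M, hence a unit, hence x_2 ... x_n is again a unit; inductively every
   letter occurring in S is a unit of M. With X_0 the set of these letters, M and the free product
   of the free group on X_0 with the free monoid on X - X_0 solve the same universal problem. *)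

theory Submission imports Defs begin

section \<open>Monoid homomorphisms\<close>

text \<open>Unlike \<open>hom\<close>, this includes preservation of the unit.\<close>

definition monoid_hom :: "('a, 'c) monoid_scheme \<Rightarrow> ('b, 'd) monoid_scheme \<Rightarrow> ('a \<Rightarrow> 'b) set" where
  "monoid_hom G H = {h \<in> hom G H. h \<one>\<^bsub>G\<^esub> = \<one>\<^bsub>H\<^esub>}"

lemma monoid_homI:
  assumes "\<And>x. x \<in> carrier G \<Longrightarrow> h x \<in> carrier H"
    and "\<And>x y. x \<in> carrier G \<Longrightarrow> y \<in> carrier G \<Longrightarrow> h (x \<otimes>\<^bsub>G\<^esub> y) = h x \<otimes>\<^bsub>H\<^esub> h y"
    and "h \<one>\<^bsub>G\<^esub> = \<one>\<^bsub>H\<^esub>"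
  shows "h \<in> monoid_hom G H"
  using assms by (auto simp: monoid_hom_def hom_def)

lemma monoid_hom_closed: "h \<in> monoid_hom G H \<Longrightarrow> x \<in> carrier G \<Longrightarrow> h x \<in> carrier H"
  by (auto simp: monoid_hom_def hom_def)

lemma monoid_hom_mult:
  "h \<in> monoid_hom G H \<Longrightarrow> x \<in> carrier G \<Longrightarrow> y \<in> carrier G \<Longrightarrow> h (x \<otimes>\<^bsub>G\<^esub> y) = h x \<otimes>\<^bsub>H\<^esub> h y"
  by (auto simp: monoid_hom_def hom_def)

lemma monoid_hom_one: "h \<in> monoid_hom G H \<Longrightarrow> h \<one>\<^bsub>G\<^esub> = \<one>\<^bsub>H\<^esub>"
  by (simp add: monoid_hom_def)

lemma monoid_hom_comp:
  "h \<in> monoid_hom G H \<Longrightarrow> k \<in> monoid_hom H K \<Longrightarrow> (\<lambda>x. k (h x)) \<in> monoid_hom G K"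
  by (rule monoid_homI) (simp_all add: monoid_hom_closed monoid_hom_mult monoid_hom_one)

lemma monoid_hom_id: "(\<lambda>x. x) \<in> monoid_hom G G"
  by (rule monoid_homI) simp_all

lemma monoid_hom_Units:
  assumes "monoid G" "h \<in> monoid_hom G H" "u \<in> Units G"
  shows "h u \<in> Units H"
proof -
  interpret G: monoid G by fact
  have "h u \<otimes>\<^bsub>H\<^esub> h (inv\<^bsub>G\<^esub> u) = \<one>\<^bsub>H\<^esub>" "h (inv\<^bsub>G\<^esub> u) \<otimes>\<^bsub>H\<^esub> h u = \<one>\<^bsub>H\<^esub>"
    using monoid_hom_mult[OF assms(2), of u "inv\<^bsub>G\<^esub> u"] monoid_hom_mult[OF assms(2), of "inv\<^bsub>G\<^esub> u" u]
      assms(3) G.Units_closed[OF assms(3)] by (simp_all add: monoid_hom_one[OF assms(2)])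
  then show ?thesis
    using assms monoid_hom_closed[OF assms(2)] unfolding Units_def[of H] by auto
qed

text \<open>\<open>h v\<close> is a left inverse and \<open>k v\<close> a right inverse of the
  common value \<open>h u = k u\<close>, so they coincide. This lets later uniqueness statements
  ignore the formal inverses \<open>Neg x\<close> and \<open>Adj w\<close>.\<close>

lemma monoid_hom_eq_on_inverse:
  assumes "monoid N" "h \<in> monoid_hom G N" "k \<in> monoid_hom G N"
    and "u \<in> carrier G" "v \<in> carrier G" "u \<otimes>\<^bsub>G\<^esub> v = \<one>\<^bsub>G\<^esub>" "v \<otimes>\<^bsub>G\<^esub> u = \<one>\<^bsub>G\<^esub>"
    and "h u = k u"
  shows "h v = k v"
proof (rule monoid.inv_unique[OF assms(1)])
  show "h v \<otimes>\<^bsub>N\<^esub> h u = \<one>\<^bsub>N\<^esub>"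
    using monoid_hom_mult[OF assms(2,5,4)] assms(7) by (simp add: monoid_hom_one[OF assms(2)])
  show "h u \<otimes>\<^bsub>N\<^esub> k v = \<one>\<^bsub>N\<^esub>"
    using monoid_hom_mult[OF assms(3,4,5)] assms(6,8) by (simp add: monoid_hom_one[OF assms(3)])
qed (use assms monoid_hom_closed in metis)+

lemma iso_of_inverse_monoid_homs:
  assumes "h \<in> monoid_hom G H" "k \<in> monoid_hom H G"
    and "\<And>x. x \<in> carrier G \<Longrightarrow> k (h x) = x" "\<And>y. y \<in> carrier H \<Longrightarrow> h (k y) = y"
  shows "h \<in> iso G H"
proof -
  have "bij_betw h (carrier G) (carrier H)"
    by (rule bij_betw_byWitness[of _ k]) (use assms monoid_hom_closed in \<open>fast+\<close>)
  then show ?thesis using assms(1) by (simp add: iso_def monoid_hom_def)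
qed

section \<open>Words and presented monoids\<close>

text \<open>The extension of \<open>f\<close> to words, multiplicative wherever the letters land in
  the carrier of a monoid. The fold ends in the unit, so a one-letter word gives \<open>f a\<close>
  times the unit, which reduces to \<open>f a\<close> once \<open>f a\<close> lies in the
  carrier.\<close>

definition word_eval :: "('b, 'c) monoid_scheme \<Rightarrow> ('a \<Rightarrow> 'b) \<Rightarrow> 'a list \<Rightarrow> 'b" where
  "word_eval N f w = foldr (\<lambda>a y. f a \<otimes>\<^bsub>N\<^esub> y) w \<one>\<^bsub>N\<^esub>"

lemma word_eval_Nil [simp]: "word_eval N f [] = \<one>\<^bsub>N\<^esub>"
  and word_eval_Cons [simp]: "word_eval N f (a # w) = f a \<otimes>\<^bsub>N\<^esub> word_eval N f w"
  by (simp_all add: word_eval_def)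

lemma word_eval_map: "word_eval N f (map g w) = word_eval N (\<lambda>a. f (g a)) w"
  by (induction w) simp_all

lemma word_eval_cong:
  "(\<And>a. a \<in> set w \<Longrightarrow> f a = g a) \<Longrightarrow> word_eval N f w = word_eval N g w"
  by (induction w) simp_all

lemma (in monoid) word_eval_closed:
  "(\<And>a. a \<in> set w \<Longrightarrow> f a \<in> carrier G) \<Longrightarrow> word_eval G f w \<in> carrier G"
  by (induction w) simp_all

lemma (in monoid) word_eval_append:
  assumes "\<And>a. a \<in> set u \<union> set v \<Longrightarrow> f a \<in> carrier G"
  shows "word_eval G f (u @ v) = word_eval G f u \<otimes> word_eval G f v"
  using assms by (induction u) (simp_all add: word_eval_closed m_assoc)

lemma (in monoid) word_eval_Units:
  "(\<And>a. a \<in> set w \<Longrightarrow> f a \<in> Units G) \<Longrightarrow> word_eval G f w \<in> Units G"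
  by (induction w) simp_all

text \<open>The algebraic core: units are peeled off from the left. Invertibility of a product gives
  its first factor a right inverse, \<open>dedekind\<close> upgrades this to a two-sided one, and
  cancelling leaves a shorter invertible product.\<close>

lemma (in monoid) letters_Units:
  assumes dedekind: "\<And>a. one_sided_invertible G a \<Longrightarrow> a \<in> Units G"
    and "\<And>a. a \<in> set w \<Longrightarrow> f a \<in> carrier G" "word_eval G f w \<in> Units G"
  shows "\<forall>a\<in>set w. f a \<in> Units G"
  using assms(2,3)
proof (induction w)
  case (Cons a w)
  let ?e = "word_eval G f w" and ?d = "inv (word_eval G f (a # w))"
  have car: "f a \<in> carrier G" "?e \<in> carrier G" "?d \<in> carrier G"
    using Cons.prems by (auto intro: word_eval_closed)
  \<comment> \<open>Reassociating \<open>(f a \<otimes> ?e) \<otimes> ?d\<close> exhibits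
    \<open>?e \<otimes> ?d\<close> as a right inverse of the first letter.\<close>
  have "f a \<otimes> (?e \<otimes> ?d) = \<one>"
    using Units_r_inv[OF Cons.prems(2)] car by (simp add: m_assoc)
  then have a: "f a \<in> Units G"
    using car by (intro dedekind) (auto simp: one_sided_invertible_def)
  \<comment> \<open>The tail is now a product of two units, so the induction hypothesis applies to
    it.\<close>
  have "?e = inv (f a) \<otimes> word_eval G f (a # w)"
    using a car by (simp flip: m_assoc)
  also have "\<dots> \<in> Units G" using a Cons.prems(2) by blast
  finally show ?case using a Cons by simp
qed simp

lemma monoid_hom_word_eval:
  assumes "monoid G" "h \<in> monoid_hom G H" "\<And>a. a \<in> set w \<Longrightarrow> f a \<in> carrier G"
  shows "h (word_eval G f w) = word_eval H (\<lambda>a. h (f a)) w"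
  using assms(3)
  by (induction w)
     (simp_all add: monoid_hom_one[OF assms(2)] monoid_hom_mult[OF assms(2)]
        monoid.word_eval_closed[OF assms(1)])

section \<open>Presented monoids and their universal property\<close>

lemma pres_class_in_carrier:
  "w \<in> lists A \<Longrightarrow> pres_class A R w \<in> carrier (presented_monoid A R)"
  by (simp add: carrier_presented_monoid)

lemma pres_class_word_eval:
  "w \<in> lists A \<Longrightarrow> pres_class A R w = word_eval (presented_monoid A R) (\<lambda>a. pres_class A R [a]) w"
proof (induction w)
  case (Cons a w)
  then show ?case using mult_presented_monoid[of "[a]" A w R] by simp
qed (simp add: one_presented_monoid)

lemma presented_monoid_rel:
  assumes "(u, v) \<in> R" "u \<in> lists A" "v \<in> lists A"
  shows "pres_class A R u = pres_class A R v"
proof -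
  have "([] @ u @ [], [] @ v @ []) \<in> monoid_cong A R"
    using assms by (intro monoid_cong.rel) simp_all
  then show ?thesis using assms by (simp add: pres_class_eq_iff)
qed

text \<open>Uniqueness half of the universal property: every element is a product of generator
  classes, so a homomorphism is determined by its values there.\<close>

lemma presented_monoid_hom_eqI:
  assumes "h \<in> monoid_hom (presented_monoid A R) N" "k \<in> monoid_hom (presented_monoid A R) N"
    and "\<And>a. a \<in> A \<Longrightarrow> h (pres_class A R [a]) = k (pres_class A R [a])"
    and "U \<in> carrier (presented_monoid A R)"
  shows "h U = k U"
proof -
  obtain w where w: "w \<in> lists A" "U = pres_class A R w"
    using assms(4) by (auto simp: carrier_presented_monoid)
  have "g U = word_eval N (\<lambda>a. g (pres_class A R [a])) w"
    if "g \<in> monoid_hom (presented_monoid A R) N" for g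
    unfolding w(2) pres_class_word_eval[OF w(1)]
    by (rule monoid_hom_word_eval[OF monoid_presented_monoid that])
       (use w in \<open>auto intro!: pres_class_in_carrier\<close>)
  moreover have "word_eval N (\<lambda>a. h (pres_class A R [a])) w
      = word_eval N (\<lambda>a. k (pres_class A R [a])) w"
    using w(1) by (intro word_eval_cong assms(3)) auto
  ultimately show ?thesis using assms(1,2) by simp
qed

text \<open>Existence half of the universal property: word evaluation is multiplicative and respects
  the relations, hence is constant on the classes of the generated congruence.\<close>

lemma presented_monoid_lift:
  assumes "monoid N" and f: "\<And>a. a \<in> A \<Longrightarrow> f a \<in> carrier N"
    and rel: "\<And>u v. (u, v) \<in> R \<Longrightarrow> u \<in> lists A \<Longrightarrow> v \<in> lists A \<Longrightarrow> word_eval N f u = word_eval N f v"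
  obtains h where "h \<in> monoid_hom (presented_monoid A R) N"
    "\<And>a. a \<in> A \<Longrightarrow> h (pres_class A R [a]) = f a"
proof -
  interpret N: monoid N by fact
  have clo: "word_eval N f w \<in> carrier N" if "w \<in> lists A" for w
    using that f by (intro N.word_eval_closed) auto
  have app: "word_eval N f (u @ v) = word_eval N f u \<otimes>\<^bsub>N\<^esub> word_eval N f v"
    if "u \<in> lists A" "v \<in> lists A" for u v
    using that f by (intro N.word_eval_append) auto
  have cong: "word_eval N f u = word_eval N f v" if "(u, v) \<in> monoid_cong A R" for u v
    using that
  proof (induction rule: monoid_cong.induct)
    case (rel u v p q)
    then show ?case using assms(3)[of u v] by (simp add: app)
  qed simp_all
  \<comment> \<open>An arbitrary representative is evaluated; \<open>cong\<close> makes the choice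
    immaterial.\<close>
  define h where "h U = word_eval N f (SOME w. w \<in> U)" for U
  have h: "h (pres_class A R w) = word_eval N f w" if "w \<in> lists A" for w
  proof -
    have "w \<in> pres_class A R w" using that by (simp add: pres_class_def monoid_cong.refl)
    then have "(SOME w'. w' \<in> pres_class A R w) \<in> pres_class A R w" by (rule someI)
    then show ?thesis unfolding h_def by (simp add: pres_class_def cong)
  qed
  show ?thesis
  proof (rule that)
    show "h \<in> monoid_hom (presented_monoid A R) N"
    proof (rule monoid_homI)
      fix U V assume "U \<in> carrier (presented_monoid A R)" "V \<in> carrier (presented_monoid A R)"
      then obtain u v where "u \<in> lists A" "v \<in> lists A" "U = pres_class A R u" "V = pres_class A R v"
        by (auto simp: carrier_presented_monoid)
      then show "h (U \<otimes>\<^bsub>presented_monoid A R\<^esub> V) = h U \<otimes>\<^bsub>N\<^esub> h V"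
        by (simp add: mult_presented_monoid h app)
    next
      show "h U \<in> carrier N" if "U \<in> carrier (presented_monoid A R)" for U
        using that h clo unfolding carrier_presented_monoid by fastforce
    qed (simp add: one_presented_monoid h)
    show "h (pres_class A R [a]) = f a" if "a \<in> A" for a
      using that f by (simp add: h)
  qed
qed

section \<open>Free groups, free monoids and free products\<close>

text \<open>The four facts come in the order of the premises of
  \<open>monoid_hom_eq_on_inverse\<close>, with \<open>[Neg x]\<close> in the role of the
  inverse.\<close>

lemma free_group_letters:
  assumes "x \<in> X"
  defines "c \<equiv> pres_class (free_group_gens X) (free_group_rels X)"
  shows "free_group_of X x \<in> carrier (free_group X)" "c [Neg x] \<in> carrier (free_group X)"
    "free_group_of X x \<otimes>\<^bsub>free_group X\<^esub> c [Neg x] = \<one>\<^bsub>free_group X\<^esub>"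
    "c [Neg x] \<otimes>\<^bsub>free_group X\<^esub> free_group_of X x = \<one>\<^bsub>free_group X\<^esub>"
proof -
  have l: "[Pos x] \<in> lists (free_group_gens X)" "[Neg x] \<in> lists (free_group_gens X)"
    "[Pos x, Neg x] \<in> lists (free_group_gens X)" "[Neg x, Pos x] \<in> lists (free_group_gens X)"
    using assms(1) by (auto simp: free_group_gens_def)
  have "c [Pos x, Neg x] = c []" "c [Neg x, Pos x] = c []"
    unfolding c_def using assms(1) l
    by (intro presented_monoid_rel; auto simp: free_group_rels_def)+
  then show "free_group_of X x \<otimes>\<^bsub>free_group X\<^esub> c [Neg x] = \<one>\<^bsub>free_group X\<^esub>"
    "c [Neg x] \<otimes>\<^bsub>free_group X\<^esub> free_group_of X x = \<one>\<^bsub>free_group X\<^esub>"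
    using l by (simp_all add: c_def free_group_def free_group_of_def mult_presented_monoid
        one_presented_monoid)
  show "free_group_of X x \<in> carrier (free_group X)" "c [Neg x] \<in> carrier (free_group X)"
    using l by (simp_all add: c_def free_group_def free_group_of_def pres_class_in_carrier)
qed

lemma monoid_free_group: "monoid (free_group X)"
  using group_free_group by (rule group.is_monoid)

lemma free_group_of_Units: "x \<in> X \<Longrightarrow> free_group_of X x \<in> Units (free_group X)"
  by (simp add: group.Units_eq[OF group_free_group] free_group_letters(1))

text \<open>The positive letters suffice, since the value at a negative letter is forced by
  uniqueness of inverses in \<open>N\<close>.\<close>

lemma free_group_hom_eqI:
  assumes "monoid N" "h \<in> monoid_hom (free_group X) N" "k \<in> monoid_hom (free_group X) N"
    and "\<And>x. x \<in> X \<Longrightarrow> h (free_group_of X x) = k (free_group_of X x)"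
    and "g \<in> carrier (free_group X)"
  shows "h g = k g"
proof (rule presented_monoid_hom_eqI[OF assms(2,3)[unfolded free_group_def] _
      assms(5)[unfolded free_group_def]])
  fix a assume "a \<in> free_group_gens X"
  then consider x where "x \<in> X" "a = Pos x" | x where "x \<in> X" "a = Neg x"
    by (auto simp: free_group_gens_def)
  then show "h (pres_class (free_group_gens X) (free_group_rels X) [a])
      = k (pres_class (free_group_gens X) (free_group_rels X) [a])"
  proof cases
    case 1
    then show ?thesis using assms(4) by (simp add: free_group_of_def)
  next
    case 2
    then show ?thesis
      using monoid_hom_eq_on_inverse[OF assms(1-3) free_group_letters assms(4)] by simp
  qed
qed

text \<open>The target is only a monoid, so the images of the generators are required to be units.
  Negative letters then go to the inverses, which makes both cancellation relations hold.\<close>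

lemma free_group_lift:
  assumes "monoid N" and f: "\<And>x. x \<in> X \<Longrightarrow> f x \<in> Units N"
  obtains h where "h \<in> monoid_hom (free_group X) N" "\<And>x. x \<in> X \<Longrightarrow> h (free_group_of X x) = f x"
proof -
  interpret N: monoid N by fact
  define e where "e a = (case a of Pos x \<Rightarrow> f x | Neg x \<Rightarrow> inv\<^bsub>N\<^esub> f x)" for a
  obtain h where h: "h \<in> monoid_hom (presented_monoid (free_group_gens X) (free_group_rels X)) N"
    "\<And>a. a \<in> free_group_gens X
      \<Longrightarrow> h (pres_class (free_group_gens X) (free_group_rels X) [a]) = e a"
    by (rule presented_monoid_lift[OF assms(1), of "free_group_gens X" e "free_group_rels X"])
       (use f N.Units_closed in \<open>auto simp: e_def free_group_gens_def free_group_rels_def\<close>)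
  show ?thesis
    by (rule that[of h]) (use h in \<open>auto simp: free_group_def free_group_of_def free_group_gens_def e_def\<close>)
qed

section \<open>Free monoids\<close>

lemma free_monoid_hom_eqI:
  assumes "h \<in> monoid_hom (free_monoid X) N" "k \<in> monoid_hom (free_monoid X) N"
    and "\<And>x. x \<in> X \<Longrightarrow> h [x] = k [x]" "w \<in> carrier (free_monoid X)"
  shows "h w = k w"
  using assms(4)
proof (induction w)
  case Nil
  then show ?case
    using monoid_hom_one[OF assms(1)] monoid_hom_one[OF assms(2)] by (simp add: free_monoid_def)
next
  case (Cons x w)
  then have "[x] \<in> carrier (free_monoid X)" "w \<in> carrier (free_monoid X)" "x \<in> X"
    by (simp_all add: free_monoid_def)
  then show ?case
    using monoid_hom_mult[OF assms(1), of "[x]" w] monoid_hom_mult[OF assms(2), of "[x]" w]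
      Cons.IH assms(3) by (simp add: free_monoid_def)
qed

lemma free_monoid_lift:
  assumes "monoid N" "\<And>x. x \<in> X \<Longrightarrow> f x \<in> carrier N"
  shows "word_eval N f \<in> monoid_hom (free_monoid X) N"
proof (rule monoid_homI)
  show "word_eval N f w \<in> carrier N" if "w \<in> carrier (free_monoid X)" for w
    using that assms(2)
    by (intro monoid.word_eval_closed[OF assms(1)]) (auto simp: free_monoid_def)
  show "word_eval N f (u \<otimes>\<^bsub>free_monoid X\<^esub> v) = word_eval N f u \<otimes>\<^bsub>N\<^esub> word_eval N f v"
    if "u \<in> carrier (free_monoid X)" "v \<in> carrier (free_monoid X)" for u v
    using that assms(2) monoid.word_eval_append[OF assms(1), of u v f]
    by (auto simp: free_monoid_def)
qed (simp add: free_monoid_def)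

lemma monoid_free_monoid: "monoid (free_monoid X)"
  by (rule monoidI) (auto simp: free_monoid_def)

section \<open>Free products as coproducts of monoids\<close>

lemma Inl_in_free_product_gens [simp]: "Inl a \<in> free_product_gens G H \<longleftrightarrow> a \<in> carrier G"
  and Inr_in_free_product_gens [simp]: "Inr b \<in> free_product_gens G H \<longleftrightarrow> b \<in> carrier H"
  by (auto simp: free_product_gens_def)

lemma monoid_free_product: "monoid (free_product G H)"
  unfolding free_product_def by (rule monoid_presented_monoid)

text \<open>The relations for the first factor, its multiplication table and the collapse of its
  unit, are exactly the homomorphism laws for the inclusion.\<close>

lemma free_product_inl_hom:
  assumes "monoid G"
  shows "free_product_inl G H \<in> monoid_hom G (free_product G H)"
proof -
  interpret monoid G by fact
  show ?thesis
  proof (rule monoid_homI)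
    fix x y assume "x \<in> carrier G" "y \<in> carrier G"
    moreover from this have
      "pres_class (free_product_gens G H) (free_product_rels G H) [Inl x, Inl y] =
        pres_class (free_product_gens G H) (free_product_rels G H) [Inl (x \<otimes>\<^bsub>G\<^esub> y)]"
      by (intro presented_monoid_rel) (simp_all add: free_product_rels_def)
    ultimately show "free_product_inl G H (x \<otimes>\<^bsub>G\<^esub> y) =
        free_product_inl G H x \<otimes>\<^bsub>free_product G H\<^esub> free_product_inl G H y"
      by (simp add: free_product_inl_def free_product_def mult_presented_monoid)
  next
    show "free_product_inl G H \<one>\<^bsub>G\<^esub> = \<one>\<^bsub>free_product G H\<^esub>"
      unfolding free_product_inl_def free_product_def one_presented_monoid
      by (rule presented_monoid_rel) (auto simp: free_product_rels_def)
  qed (simp add: free_product_inl_def free_product_def pres_class_in_carrier)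
qed

lemma free_product_inr_hom:
  assumes "monoid H"
  shows "free_product_inr G H \<in> monoid_hom H (free_product G H)"
proof -
  interpret monoid H by fact
  show ?thesis
  proof (rule monoid_homI)
    fix x y assume "x \<in> carrier H" "y \<in> carrier H"
    moreover from this have
      "pres_class (free_product_gens G H) (free_product_rels G H) [Inr x, Inr y] =
        pres_class (free_product_gens G H) (free_product_rels G H) [Inr (x \<otimes>\<^bsub>H\<^esub> y)]"
      by (intro presented_monoid_rel) (simp_all add: free_product_rels_def)
    ultimately show "free_product_inr G H (x \<otimes>\<^bsub>H\<^esub> y) =
        free_product_inr G H x \<otimes>\<^bsub>free_product G H\<^esub> free_product_inr G H y"
      by (simp add: free_product_inr_def free_product_def mult_presented_monoid)
  next
    show "free_product_inr G H \<one>\<^bsub>H\<^esub> = \<one>\<^bsub>free_product G H\<^esub>"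
      unfolding free_product_inr_def free_product_def one_presented_monoid
      by (rule presented_monoid_rel) (auto simp: free_product_rels_def)
  qed (simp add: free_product_inr_def free_product_def pres_class_in_carrier)
qed

text \<open>The generators of the presentation are precisely the elements of the two
  factors.\<close>

lemma free_product_hom_eqI:
  assumes "h \<in> monoid_hom (free_product G H) N" "k \<in> monoid_hom (free_product G H) N"
    and "\<And>a. a \<in> carrier G \<Longrightarrow> h (free_product_inl G H a) = k (free_product_inl G H a)"
    and "\<And>b. b \<in> carrier H \<Longrightarrow> h (free_product_inr G H b) = k (free_product_inr G H b)"
    and "p \<in> carrier (free_product G H)"
  shows "h p = k p"
  by (rule presented_monoid_hom_eqI[OF assms(1,2)[unfolded free_product_def] _
        assms(5)[unfolded free_product_def]])
     (use assms(3,4) in \<open>auto simp: free_product_gens_def free_product_inl_def free_product_inr_def\<close>)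

text \<open>Existence half of the coproduct property, obtained by evaluating words with
  \<open>f\<close> on left letters and \<open>g\<close> on right letters.\<close>

lemma free_product_lift:
  assumes "monoid N" and f: "f \<in> monoid_hom G N" and g: "g \<in> monoid_hom H N"
  obtains h where "h \<in> monoid_hom (free_product G H) N"
    "\<And>a. a \<in> carrier G \<Longrightarrow> h (free_product_inl G H a) = f a"
    "\<And>b. b \<in> carrier H \<Longrightarrow> h (free_product_inr G H b) = g b"
proof -
  interpret N: monoid N by fact
  let ?A = "free_product_gens G H" and ?R = "free_product_rels G H"
  have car: "case_sum f g a \<in> carrier N" if "a \<in> ?A" for a
    using that monoid_hom_closed[OF f] monoid_hom_closed[OF g]
    by (auto simp: free_product_gens_def)
  \<comment> \<open>The multiplication tables are respected by multiplicativity. Erasing the two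
    unit letters is respected because elements of \<open>monoid_hom\<close> preserve the
    unit.\<close>
  have rel: "word_eval N (case_sum f g) u = word_eval N (case_sum f g) v" if "(u, v) \<in> ?R" for u v
    using that monoid_hom_closed[OF f] monoid_hom_closed[OF g]
    by (auto simp: free_product_rels_def monoid_hom_mult[OF f] monoid_hom_mult[OF g]
        monoid_hom_one[OF f] monoid_hom_one[OF g])
  obtain h where h: "h \<in> monoid_hom (presented_monoid ?A ?R) N"
    "\<And>a. a \<in> ?A \<Longrightarrow> h (pres_class ?A ?R [a]) = case_sum f g a"
    using presented_monoid_lift[OF assms(1) car rel] by blast
  show ?thesis
    by (rule that[of h])
       (use h in \<open>simp_all add: free_product_def free_product_inl_def free_product_inr_def\<close>)
qed

section \<open>Adjoining inverses\<close>

lemma monoid_adj_monoid: "monoid (adj_monoid X S)"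
  unfolding adj_monoid_def by (rule monoid_presented_monoid)

lemma adj_of_closed: "x \<in> X \<Longrightarrow> adj_of X S x \<in> carrier (adj_monoid X S)"
  unfolding adj_of_def adj_monoid_def
  by (rule pres_class_in_carrier) (auto simp: adj_gens_def)

text \<open>The defining relations make the class of \<open>Adj w\<close> inverse to the image of
  \<open>w\<close>. The explicit inverse is kept, rather than mere invertibility, so that
  homomorphisms can be compared on it.\<close>

lemma adj_monoid_word_inverse:
  assumes "w \<in> S" "w \<in> lists X"
  defines "c \<equiv> pres_class (adj_gens X S) (adj_rels S)"
  shows "c [Adj w] \<in> carrier (adj_monoid X S)"
    "word_eval (adj_monoid X S) (adj_of X S) w \<otimes>\<^bsub>adj_monoid X S\<^esub> c [Adj w] = \<one>\<^bsub>adj_monoid X S\<^esub>"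
    "c [Adj w] \<otimes>\<^bsub>adj_monoid X S\<^esub> word_eval (adj_monoid X S) (adj_of X S) w = \<one>\<^bsub>adj_monoid X S\<^esub>"
proof -
  have l: "[Adj w] \<in> lists (adj_gens X S)" "map Gen w \<in> lists (adj_gens X S)"
    using assms(1,2) by (auto simp: adj_gens_def)
  have e: "word_eval (adj_monoid X S) (adj_of X S) w = c (map Gen w)"
    unfolding c_def pres_class_word_eval[OF l(2)]
    by (simp add: word_eval_map adj_monoid_def adj_of_def[abs_def])
  have "c (map Gen w @ [Adj w]) = c []" "c ([Adj w] @ map Gen w) = c []"
    unfolding c_def using assms(1) l
    by (intro presented_monoid_rel; force simp: adj_rels_def)+
  then show
    "word_eval (adj_monoid X S) (adj_of X S) w \<otimes>\<^bsub>adj_monoid X S\<^esub> c [Adj w] = \<one>\<^bsub>adj_monoid X S\<^esub>"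
    "c [Adj w] \<otimes>\<^bsub>adj_monoid X S\<^esub> word_eval (adj_monoid X S) (adj_of X S) w = \<one>\<^bsub>adj_monoid X S\<^esub>"
    unfolding e using l
    by (simp_all only: c_def adj_monoid_def mult_presented_monoid one_presented_monoid)
  show "c [Adj w] \<in> carrier (adj_monoid X S)"
    using l by (simp add: c_def adj_monoid_def pres_class_in_carrier)
qed

lemma adj_monoid_word_Units:
  assumes "w \<in> S" "w \<in> lists X"
  shows "word_eval (adj_monoid X S) (adj_of X S) w \<in> Units (adj_monoid X S)"
proof -
  have "word_eval (adj_monoid X S) (adj_of X S) w \<in> carrier (adj_monoid X S)"
    using assms(2) by (intro monoid.word_eval_closed[OF monoid_adj_monoid] adj_of_closed) auto
  then show ?thesis
    using adj_monoid_word_inverse[OF assms] by (auto simp: Units_def)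
qed

text \<open>Agreement on the letters gives agreement on the image of each \<open>w\<close> in
  \<open>S\<close>, and then on its inverse, the class of \<open>Adj w\<close>.\<close>

lemma adj_monoid_hom_eqI:
  assumes "S \<subseteq> lists X" "monoid N"
    and h: "h \<in> monoid_hom (adj_monoid X S) N" and k: "k \<in> monoid_hom (adj_monoid X S) N"
    and eq: "\<And>x. x \<in> X \<Longrightarrow> h (adj_of X S x) = k (adj_of X S x)"
    and m: "m \<in> carrier (adj_monoid X S)"
  shows "h m = k m"
proof (rule presented_monoid_hom_eqI[OF h[unfolded adj_monoid_def] k[unfolded adj_monoid_def] _
      m[unfolded adj_monoid_def]])
  fix a assume "a \<in> adj_gens X S"
  then consider x where "x \<in> X" "a = Gen x" | w where "w \<in> S" "a = Adj w"
    by (auto simp: adj_gens_def)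
  then show "h (pres_class (adj_gens X S) (adj_rels S) [a])
      = k (pres_class (adj_gens X S) (adj_rels S) [a])"
  proof cases
    case 1
    then show ?thesis using eq by (simp add: adj_of_def)
  next
    case 2
    then have w: "w \<in> lists X" "set w \<subseteq> X" using assms(1) by auto
    have car: "\<And>x. x \<in> set w \<Longrightarrow> adj_of X S x \<in> carrier (adj_monoid X S)"
      using w by (auto intro: adj_of_closed)
    have "h (word_eval (adj_monoid X S) (adj_of X S) w)
        = k (word_eval (adj_monoid X S) (adj_of X S) w)"
      using w eq car
      by (auto simp: monoid_hom_word_eval[OF monoid_adj_monoid h]
          monoid_hom_word_eval[OF monoid_adj_monoid k] intro!: word_eval_cong)
    then show ?thesis
      using monoid_hom_eq_on_inverse[OF assms(2) h k
          monoid.word_eval_closed[OF monoid_adj_monoid car] adj_monoid_word_inverse[OF 2(1) w(1)]]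
      by (simp add: 2(2))
  qed
qed

text \<open>Existence half of the universal property of adjoining inverses: \<open>Adj w\<close> is
  sent to the inverse of the value of \<open>w\<close>, which exists by \<open>unit\<close>.\<close>

lemma adj_monoid_lift:
  assumes "S \<subseteq> lists X" "monoid N" and f: "\<And>x. x \<in> X \<Longrightarrow> f x \<in> carrier N"
    and unit: "\<And>w. w \<in> S \<Longrightarrow> word_eval N f w \<in> Units N"
  obtains h where "h \<in> monoid_hom (adj_monoid X S) N" "\<And>x. x \<in> X \<Longrightarrow> h (adj_of X S x) = f x"
proof -
  interpret N: monoid N by fact
  let ?A = "adj_gens X S" and ?R = "adj_rels S"
  define e where "e a = (case a of Gen x \<Rightarrow> f x | Adj w \<Rightarrow> inv\<^bsub>N\<^esub> word_eval N f w)" for a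
  have car: "e a \<in> carrier N" if "a \<in> ?A" for a
    using that f unit by (auto simp: adj_gens_def e_def)
  have e: "word_eval N e (map Gen w) = word_eval N f w" for w
    by (simp add: word_eval_map e_def)
  have rel: "word_eval N e u = word_eval N e v"
    if uv: "(u, v) \<in> ?R" "u \<in> lists ?A" "v \<in> lists ?A" for u v
  proof -
    obtain w where w: "w \<in> S" "v = []" "u = map Gen w @ [Adj w] \<or> u = [Adj w] @ map Gen w"
      using uv(1) by (auto simp: adj_rels_def)
    have l: "e a \<in> carrier N" if "a \<in> set (map Gen w) \<union> {Adj w}" for a
      using that w(1) assms(1) by (intro car) (auto simp: adj_gens_def)
    have "word_eval N e (map Gen w @ [Adj w]) = word_eval N e (map Gen w) \<otimes>\<^bsub>N\<^esub> word_eval N e [Adj w]"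
      "word_eval N e ([Adj w] @ map Gen w) = word_eval N e [Adj w] \<otimes>\<^bsub>N\<^esub> word_eval N e (map Gen w)"
      by (rule N.word_eval_append, rule l, fastforce)+
    moreover have "word_eval N e [Adj w] = inv\<^bsub>N\<^esub> word_eval N f w"
      using unit[OF w(1)] by (simp add: e_def)
    ultimately have "word_eval N e (map Gen w @ [Adj w]) = \<one>\<^bsub>N\<^esub>"
      "word_eval N e ([Adj w] @ map Gen w) = \<one>\<^bsub>N\<^esub>"
      using unit[OF w(1)] by (simp_all only: e N.Units_r_inv N.Units_l_inv)
    then show ?thesis using w(2,3) by auto
  qed
  obtain h where h: "h \<in> monoid_hom (presented_monoid ?A ?R) N"
    "\<And>a. a \<in> ?A \<Longrightarrow> h (pres_class ?A ?R [a]) = e a"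
    using presented_monoid_lift[OF assms(2) car rel] by blast
  show ?thesis
    by (rule that[of h])
       (use h in \<open>auto simp: adj_monoid_def adj_of_def adj_gens_def e_def\<close>)
qed

text \<open>Criterion for \<open>N\<close> to solve the same universal problem; it serves both for
  the free product and for the free group. The lift \<open>h\<close> of \<open>j\<close> is inverse
  to \<open>k\<close>: one composite fixes every \<open>adj_of X S x\<close>, the other every
  \<open>j x\<close>, and \<open>rigid\<close> forces the latter to be the identity.\<close>

lemma adj_monoid_isoI:
  assumes S: "S \<subseteq> lists X" and "monoid N" and j: "\<And>x. x \<in> X \<Longrightarrow> j x \<in> carrier N"
    and unit: "\<And>w x. w \<in> S \<Longrightarrow> x \<in> set w \<Longrightarrow> j x \<in> Units N"
    and k: "k \<in> monoid_hom N (adj_monoid X S)" "\<And>x. x \<in> X \<Longrightarrow> k (j x) = adj_of X S x"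
    and rigid: "\<And>e y. e \<in> monoid_hom N N \<Longrightarrow> (\<And>x. x \<in> X \<Longrightarrow> e (j x) = j x) \<Longrightarrow> y \<in> carrier N \<Longrightarrow> e y = y"
  shows "\<exists>h\<in>iso (adj_monoid X S) N. \<forall>x\<in>X. h (adj_of X S x) = j x"
proof -
  obtain h where h: "h \<in> monoid_hom (adj_monoid X S) N" "\<And>x. x \<in> X \<Longrightarrow> h (adj_of X S x) = j x"
    by (rule adj_monoid_lift[OF S assms(2), of j])
       (use j in \<open>auto intro: monoid.word_eval_Units[OF assms(2)] unit\<close>)
  have "h \<in> iso (adj_monoid X S) N"
  proof (rule iso_of_inverse_monoid_homs[OF h(1) k(1)])
    show "k (h m) = m" if "m \<in> carrier (adj_monoid X S)" for m
      by (rule adj_monoid_hom_eqI[OF S monoid_adj_monoid monoid_hom_comp[OF h(1) k(1)]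
            monoid_hom_id _ that]) (simp add: h(2) k(2))
    show "h (k y) = y" if "y \<in> carrier N" for y
      by (rule rigid[OF monoid_hom_comp[OF k(1) h(1)] _ that]) (simp add: h(2) k(2))
  qed
  then show ?thesis using h(2) by blast
qed

theorem mainTheorem3:
  fixes X :: "'a set" and S :: "'a list set"
  assumes "finite S" and "S \<subseteq> carrier (free_monoid X)"
  shows "(\<exists>X0\<subseteq>X.
      (\<exists>h\<in>iso (adj_monoid X S) (free_product (free_group X0) (free_monoid (X - X0))).
        (\<forall>x\<in>X0. h (adj_of X S x) =
          free_product_inl (free_group X0) (free_monoid (X - X0)) (free_group_of X0 x)) \<and>
        (\<forall>x\<in>X - X0. h (adj_of X S x) =
          free_product_inr (free_group X0) (free_monoid (X - X0)) [x])) \<and>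
      (X0 = X \<longrightarrow>
        (\<exists>g\<in>iso (adj_monoid X S) (free_group X). \<forall>x\<in>X. g (adj_of X S x) = free_group_of X x)))
    \<or> (\<exists>a. one_sided_invertible (adj_monoid X S) a \<and> a \<notin> Units (adj_monoid X S))"
proof (rule disjCI)
  assume "\<nexists>a. one_sided_invertible (adj_monoid X S) a \<and> a \<notin> Units (adj_monoid X S)"
  then have dedekind: "\<And>a. one_sided_invertible (adj_monoid X S) a \<Longrightarrow> a \<in> Units (adj_monoid X S)"
    by blast
  have S: "S \<subseteq> lists X" using assms(2) by (simp add: free_monoid_def)
  \<comment> \<open>The letters occurring in words of \<open>S\<close>.\<close>
  define X0 where "X0 = \<Union>(set ` S)"
  have X0: "X0 \<subseteq> X" using S by (auto simp: X0_def)
  \<comment> \<open>The image of each word of \<open>S\<close> is a unit by construction;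
    \<open>letters_Units\<close> passes this on to its letters.\<close>
  have unit: "adj_of X S x \<in> Units (adj_monoid X S)" if x: "x \<in> X0" for x
  proof -
    obtain w where w: "w \<in> S" "x \<in> set w" using x unfolding X0_def by blast
    then have "w \<in> lists X" using S by blast
    then have "\<forall>x\<in>set w. adj_of X S x \<in> Units (adj_monoid X S)"
      using w(1) by (intro monoid.letters_Units[OF monoid_adj_monoid dedekind]
          adj_monoid_word_Units adj_of_closed) auto
    then show ?thesis using w(2) by blast
  qed
  obtain \<phi> where \<phi>: "\<phi> \<in> monoid_hom (free_group X0) (adj_monoid X S)"
    "\<And>x. x \<in> X0 \<Longrightarrow> \<phi> (free_group_of X0 x) = adj_of X S x"
    using free_group_lift[where X = X0 and f = "adj_of X S", OF monoid_adj_monoid unit] by blast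

  let ?G = "free_group X0" and ?H = "free_monoid (X - X0)"
  let ?P = "free_product ?G ?H"
  \<comment> \<open>The natural map from \<open>X\<close> to the free product, with letters of
    \<open>X0\<close> landing in the group factor.\<close>
  define j where "j x = (if x \<in> X0 then free_product_inl ?G ?H (free_group_of X0 x)
      else free_product_inr ?G ?H [x])" for x
  note inl = free_product_inl_hom[OF monoid_free_group[of X0], of ?H]
    and inr = free_product_inr_hom[OF monoid_free_monoid[of "X - X0"], of ?G]
  have letter: "[x] \<in> carrier ?H" if "x \<in> X - X0" for x
    using that by (simp add: free_monoid_def)
  define \<psi> where "\<psi> = word_eval (adj_monoid X S) (adj_of X S)"
  have \<psi>: "\<psi> \<in> monoid_hom ?H (adj_monoid X S)"
    unfolding \<psi>_def by (rule free_monoid_lift[OF monoid_adj_monoid]) (simp add: adj_of_closed)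
  have \<psi>_letter: "\<psi> [x] = adj_of X S x" if "x \<in> X" for x
    using adj_of_closed[OF that] by (simp add: \<psi>_def monoid.r_one[OF monoid_adj_monoid])
  \<comment> \<open>The candidate inverse isomorphism, glued from \<open>\<phi>\<close> on the group
    factor and \<open>\<psi>\<close> on the free monoid factor.\<close>
  obtain k where k: "k \<in> monoid_hom ?P (adj_monoid X S)"
    "\<And>a. a \<in> carrier ?G \<Longrightarrow> k (free_product_inl ?G ?H a) = \<phi> a"
    "\<And>b. b \<in> carrier ?H \<Longrightarrow> k (free_product_inr ?G ?H b) = \<psi> b"
    using free_product_lift[OF monoid_adj_monoid \<phi>(1) \<psi>] by blast
  have "\<exists>h\<in>iso (adj_monoid X S) ?P. \<forall>x\<in>X. h (adj_of X S x) = j x"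
  proof (rule adj_monoid_isoI[OF S monoid_free_product _ _ k(1)])
    show "j x \<in> carrier ?P" if "x \<in> X" for x
      using that letter by (simp add: j_def monoid_hom_closed[OF inl] monoid_hom_closed[OF inr]
          free_group_letters(1))
    \<comment> \<open>Every letter of a word of \<open>S\<close> lies in \<open>X0\<close>, so
      \<open>j x\<close> is the image of a group element under a unit-preserving
      homomorphism.\<close>
    show "j x \<in> Units ?P" if "w \<in> S" "x \<in> set w" for w x
    proof -
      have "x \<in> X0" using that by (auto simp: X0_def)
      then show ?thesis
        by (simp add: j_def monoid_hom_Units[OF monoid_free_group inl] free_group_of_Units)
    qed
    show "k (j x) = adj_of X S x" if "x \<in> X" for x
      using that letter by (simp add: j_def k \<phi> \<psi>_letter free_group_letters(1))
    \<comment> \<open>Rigidity is reduced first to the two factors and then, inside each factor, to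
      its free generators, which are the values of \<open>j\<close>.\<close>
    show "e y = y" if e: "e \<in> monoid_hom ?P ?P" "\<And>x. x \<in> X \<Longrightarrow> e (j x) = j x"
      and y: "y \<in> carrier ?P" for e y
    proof (rule free_product_hom_eqI[OF e(1) monoid_hom_id _ _ y])
      show "e (free_product_inl ?G ?H a) = free_product_inl ?G ?H a" if "a \<in> carrier ?G" for a
      proof (rule free_group_hom_eqI[OF monoid_free_product monoid_hom_comp[OF inl e(1)] inl _ that])
        show "e (free_product_inl ?G ?H (free_group_of X0 x)) =
            free_product_inl ?G ?H (free_group_of X0 x)" if "x \<in> X0" for x
          using e(2)[of x] that X0 by (auto simp: j_def)
      qed
      show "e (free_product_inr ?G ?H b) = free_product_inr ?G ?H b" if "b \<in> carrier ?H" for b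
      proof (rule free_monoid_hom_eqI[OF monoid_hom_comp[OF inr e(1)] inr _ that])
        show "e (free_product_inr ?G ?H [x]) = free_product_inr ?G ?H [x]" if "x \<in> X - X0" for x
          using e(2)[of x] that by (auto simp: j_def)
      qed
    qed
  qed
  then obtain h where h: "h \<in> iso (adj_monoid X S) ?P" "\<And>x. x \<in> X \<Longrightarrow> h (adj_of X S x) = j x"
    by blast
  \<comment> \<open>Instead of collapsing a free product with the free monoid on the empty set, the
    criterion is applied again with the free group as \<open>N\<close> and \<open>\<phi>\<close> as
    the inverse map.\<close>
  have full: "\<exists>g\<in>iso (adj_monoid X S) (free_group X). \<forall>x\<in>X. g (adj_of X S x) = free_group_of X x"
    if "X0 = X"
  proof (rule adj_monoid_isoI[OF S monoid_free_group _ _ \<phi>(1)[unfolded that]])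
    show "free_group_of X x \<in> Units (free_group X)" if "w \<in> S" "x \<in> set w" for w x
      using that S by (intro free_group_of_Units) auto
    show "e y = y" if "e \<in> monoid_hom (free_group X) (free_group X)"
      "\<And>x. x \<in> X \<Longrightarrow> e (free_group_of X x) = free_group_of X x" "y \<in> carrier (free_group X)" for e y
      by (rule free_group_hom_eqI[OF monoid_free_group that(1) monoid_hom_id that(2,3)])
  qed (use \<phi>(2) that free_group_letters(1) in auto)
  have gens: "(\<forall>x\<in>X0. h (adj_of X S x) = free_product_inl ?G ?H (free_group_of X0 x)) \<and>
      (\<forall>x\<in>X - X0. h (adj_of X S x) = free_product_inr ?G ?H [x])"
    using h(2) X0 by (auto simp: j_def)
  show "\<exists>X0\<subseteq>X.
      (\<exists>h\<in>iso (adj_monoid X S) (free_product (free_group X0) (free_monoid (X - X0))).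
        (\<forall>x\<in>X0. h (adj_of X S x) =
          free_product_inl (free_group X0) (free_monoid (X - X0)) (free_group_of X0 x)) \<and>
        (\<forall>x\<in>X - X0. h (adj_of X S x) =
          free_product_inr (free_group X0) (free_monoid (X - X0)) [x])) \<and>
      (X0 = X \<longrightarrow>
        (\<exists>g\<in>iso (adj_monoid X S) (free_group X). \<forall>x\<in>X. g (adj_of X S x) = free_group_of X x))"
    by (intro exI[of _ X0] conjI impI, rule X0, rule bexI[OF _ h(1)], rule gens, erule full)
qed

end
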